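(* Let $0<p<1$. For every $n\ge1$ and every unit vector $a=(a_1,\dots,a_n)\in\mathbb{R}^n$ (that is, $\sum_{j=1}^n a_j^2=1$), we have $$h_p(U_1)\le h_p\left(\sum_{j=1}^n a_jU_j\right)\le h_p\left(Z/\sqrt{3}\right).$$
   Context: $U_1,U_2,\dots$ are independent random variables, each uniformly distributed on $[-1,1]$, and $Z$ is a standard $N(0,1)$ Gaussian random variable. For $0<p<1$, the $p$-Rényi entropy of a real random variable $X$ with density $f$ (with respect to Lebesgue measure on $\mathbb{R}$) is $$h_p(X)=\frac{1}{1-p}\log\left(\int_{\mathbb{R}}f^p\right).$$ *)

theory Defs
  imports "HOL-Probability.Probability"
begin

definition ln_ennreal :: "ennreal \<Rightarrow> ereal" where
  "ln_ennreal x =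
     (if x = 0 then -\<infinity> else if x = \<top> then \<infinity> else ereal (ln (enn2real x)))"

text \<open>The density of \<open>X\<close> is the Radon-Nikodym derivative of its law with respect to Lebesgue
  measure, as in the library's \<^const>\<open>prob_space.entropy\<close>; the lemma below shows that any other
  density gives the same value. The integral is taken in \<open>[0, \<infinity>]\<close>, so that no
  integrability convention enters. If the law of \<open>X\<close> has no density, then \<^const>\<open>RN_deriv\<close> is the
  zero function; for \<open>0 < p < 1\<close> the value is then \<open>-\<infinity>\<close>, which no random variable with a
  density attains.\<close>

definition renyi_entropy :: "'a measure \<Rightarrow> real \<Rightarrow> ('a \<Rightarrow> real) \<Rightarrow> ereal" where
  "renyi_entropy M p X =
     ereal (1 / (1 - p)) *
     ln_ennreal (\<integral>\<^sup>+ x. ennreal (enn2real (RN_deriv lborel (distr M lborel X) x) powr p) \<partial>lborel)"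

lemma renyi_entropy_distributed:
  fixes f :: "real \<Rightarrow> real"
  assumes "distributed M lborel X (\<lambda>x. ennreal (f x))" "\<And>x. 0 \<le> f x"
  shows "renyi_entropy M p X =
     ereal (1 / (1 - p)) * ln_ennreal (\<integral>\<^sup>+ x. ennreal (f x powr p) \<partial>lborel)"
proof -
  have m: "(\<lambda>x. ennreal (f x)) \<in> borel_measurable lborel"
    using assms(1) by (rule distributed_borel_measurable)
  have d: "density lborel (\<lambda>x. ennreal (f x)) = distr M lborel X"
    using distributed_distr_eq_density[OF assms(1)] by simp
  have "AE x in lborel. ennreal (f x) = RN_deriv lborel (distr M lborel X) x"
    by (rule sigma_finite_measure.RN_deriv_unique[OF sigma_finite_lborel m d])
  then have "AE x in lborel. ennreal (enn2real (RN_deriv lborel (distr M lborel X) x) powr p)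
      = ennreal (f x powr p)"
    by eventually_elim (metis assms(2) enn2real_ennreal)
  then show ?thesis
    unfolding renyi_entropy_def by (simp only: nn_integral_cong_AE)
qed

end

theory Submission
  imports Defs
begin

text \<open>
  Upper bound: the affine bound \<open>f\<^sup>p \<le> (1 - p) g\<^sup>p + p f g\<^sup>p\<^sup>-\<^sup>1\<close>, with \<open>g\<close> the Gaussian density of the same
  variance, reduces the claim to \<open>E exp (c X\<^sup>2) \<le> E exp (c Z\<^sup>2 / 3)\<close>. Writing the exponential of a
  square as a Gaussian mixture of exponentials turns this into the comparison of moment generating
  functions \<open>sinh r / r \<le> exp (r\<^sup>2 / 6)\<close>.

  Lower bound: in the spirit of Rioul's transport proof of the entropy power inequality, write
  \<open>U\<^sub>j = T (G\<^sub>j)\<close> with \<open>G\<close> standard Gaussian and \<open>T' = 2 \<phi>\<close>. Moving \<open>G\<close> along the unit vector \<open>a\<close> changes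
  \<open>X = \<Sum> a\<^sub>j T (G\<^sub>j)\<close> at the rate \<open>D = \<Sum> a\<^sub>j\<^sup>2 T' (G\<^sub>j)\<close>, so \<open>\<phi> (\<langle>a, G\<rangle>) / D\<close> is the conditional density of \<open>X\<close>
  given the part of \<open>G\<close> orthogonal to \<open>a\<close>. Gibbs' inequality then bounds the entropy of \<open>X\<close> from below
  by \<open>E ln D - E ln \<phi> (\<langle>a, G\<rangle>)\<close>, which is at least \<open>ln 2\<close> by concavity of the logarithm because
  \<open>\<langle>a, G\<rangle>\<close> and each \<open>G\<^sub>j\<close> have the same law; for \<open>p < 1\<close> the Renyi entropy is only larger.
\<close>

section \<open>Reference laws, substitution on the line and comparison of probability
  measures\<close>

abbreviation std_normal :: "real measure" where
  "std_normal \<equiv> density lborel std_normal_density"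

abbreviation uniform :: "real measure" where
  "uniform \<equiv> uniform_measure lborel {-1..1}"

lemma borel_measurable_has_real_derivative:
  fixes T t :: "real \<Rightarrow> real"
  assumes "\<And>x. (T has_real_derivative t x) (at x)"
  shows "T \<in> borel_measurable borel"
  using assms by (intro borel_measurable_continuous_onI) (meson DERIV_isCont continuous_at_imp_continuous_on)

text \<open>On each \<open>{- real k..real k}\<close> the substitution rule turns the left side into
  the integral of \<open>f\<close> over \<open>{g (- real k)..g (real k)}\<close>; monotone
  convergence lets \<open>k\<close> grow. Only an inequality comes out, because the range of
  \<open>g\<close> may miss part of the line.\<close>

lemma nn_integral_substitution_le:
  fixes f g g' :: "real \<Rightarrow> real"
  assumes f [measurable]: "f \<in> borel_measurable borel"
    and g: "\<And>x. (g has_real_derivative g' x) (at x)"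
    and g': "continuous_on UNIV g'" "\<And>x. 0 \<le> g' x"
    and nonneg: "\<And>x. 0 \<le> f x"
  shows "(\<integral>\<^sup>+ x. f (g x) * g' x \<partial>lborel) \<le> (\<integral>\<^sup>+ x. f x \<partial>lborel)"
proof -
  have [measurable]: "g' \<in> borel_measurable borel"
    by (rule borel_measurable_continuous_onI[OF g'(1)])
  note [measurable] = borel_measurable_has_real_derivative[OF g]
  define h where "h k x = ennreal (f (g x) * g' x) * indicator {- real k..real k} x" for k x
  have h_le: "(\<integral>\<^sup>+ x. h k x \<partial>lborel) \<le> (\<integral>\<^sup>+ x. f x \<partial>lborel)" for k
  proof -
    have "(\<integral>\<^sup>+ x. h k x \<partial>lborel)
        = (\<integral>\<^sup>+ x. ennreal (f (g x) * g' x * indicator {- real k..real k} x) \<partial>lborel)"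
      unfolding h_def by (intro nn_integral_cong) (auto split: split_indicator)
    also have "\<dots> = (\<integral>\<^sup>+ x. ennreal (f x * indicator {g (- real k)..g (real k)} x) \<partial>lborel)"
      using g g' by (intro nn_integral_substitution[symmetric])
        (auto simp: set_borel_measurable_def intro: continuous_on_subset)
    also have "\<dots> \<le> (\<integral>\<^sup>+ x. f x \<partial>lborel)"
      using nonneg by (intro nn_integral_mono) (auto split: split_indicator)
    finally show ?thesis .
  qed
  have "(\<integral>\<^sup>+ x. f (g x) * g' x \<partial>lborel) = (\<integral>\<^sup>+ x. (SUP k. h k x) \<partial>lborel)"
  proof (intro nn_integral_cong antisym)
    fix x
    obtain k :: nat where "\<bar>x\<bar> \<le> real k"
      using real_arch_simple by blast
    then have "ennreal (f (g x) * g' x) = h k x"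
      by (auto simp: h_def indicator_def)
    then show "ennreal (f (g x) * g' x) \<le> (SUP k. h k x)"
      by (simp only:) (rule SUP_upper, simp)
    show "(SUP k. h k x) \<le> ennreal (f (g x) * g' x)"
      by (auto simp: h_def intro!: SUP_least split: split_indicator)
  qed
  also have "\<dots> = (SUP k. \<integral>\<^sup>+ x. h k x \<partial>lborel)"
    by (rule nn_integral_monotone_convergence_SUP)
      (auto simp: incseq_def le_fun_def h_def split: split_indicator)
  also have "\<dots> \<le> (\<integral>\<^sup>+ x. f x \<partial>lborel)"
    using h_le by (rule SUP_least)
  finally show ?thesis .
qed

text \<open>The bounds for \<open>A\<close> and for its complement, with total mass 1 on both sides,
  force equality. Thus one-sided estimates such as \<open>nn_integral_substitution_le\<close>
  suffice to identify a law.\<close>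

lemma prob_space_eqI_le:
  assumes M: "prob_space M" and N: "prob_space N" and sets: "sets M = sets N"
    and le: "\<And>A. A \<in> sets M \<Longrightarrow> emeasure M A \<le> emeasure N A"
  shows "M = N"
proof (rule measure_eqI[OF sets])
  interpret M: prob_space M by fact
  interpret N: prob_space N by fact
  fix A assume A: "A \<in> sets M"
  have "measure M A \<le> measure N A"
    using le[OF A] by (simp add: M.emeasure_eq_measure N.emeasure_eq_measure)
  moreover have "measure M (space M - A) \<le> measure N (space N - A)"
    using le[OF sets.compl_sets[OF A]] sets_eq_imp_space_eq[OF sets]
    by (simp add: M.emeasure_eq_measure N.emeasure_eq_measure)
  ultimately show "emeasure M A = emeasure N A"
    using M.prob_compl[of A] N.prob_compl[of A] A sets
    by (simp add: M.emeasure_eq_measure N.emeasure_eq_measure)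
qed

section \<open>Transport of the Gaussian law to the uniform law\<close>

lemma continuous_on_std_normal_density: "continuous_on A std_normal_density"
  unfolding std_normal_density_def by (intro continuous_intros) auto

lemma prob_space_std_normal: "prob_space std_normal"
  by (rule prob_space_normal_density) simp

lemma prob_space_uniform: "prob_space uniform"
  by (rule prob_space_uniform_measure) auto

lemma nn_integral_uniform:
  assumes [measurable]: "h \<in> borel_measurable borel"
  shows "(\<integral>\<^sup>+ x. h x \<partial>uniform) = (\<integral>\<^sup>+ x. h x * indicator {-1..1} x \<partial>lborel) / 2"
  by (subst nn_integral_uniform_measure) auto

text \<open>The witness is 2 \<Phi> - 1 with \<Phi> the Gaussian distribution function; the factor 2
  in its derivative cancels the height 1/2 of the uniform density.\<close>

lemma std_normal_uniform_transport:
  "\<exists>T. (\<forall>x. (T has_real_derivative 2 * std_normal_density x) (at x)) \<and>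
    distr std_normal borel T = uniform"
proof -
  interpret G: prob_space std_normal
    by (rule prob_space_std_normal)
  define T where "T x = 2 * measure std_normal {..x} - 1" for x
  \<comment> \<open>An antiderivative of the density supplies differentiability; \<open>diff\<close>
    then shows that \<open>T\<close> equals \<open>2 * F\<close> up to a constant.\<close>
  obtain F where F: "\<And>x. (F has_real_derivative std_normal_density x) (at x)"
    using einterval_antiderivative[of "-\<infinity>" "\<infinity>" std_normal_density]
      continuous_on_std_normal_density[of UNIV]
    by (auto simp: has_real_derivative_iff_has_vector_derivative continuous_on_eq_continuous_at)
  have diff: "T y - T x = 2 * (F y - F x)" if "x \<le> y" for x y
  proof -
    have mono: "F x \<le> F y"
      using F that by (intro DERIV_nonneg_imp_nondecreasing[OF that]) (metis normal_density_nonneg)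
    have "emeasure std_normal {x<..y} = (\<integral>\<^sup>+ t. ennreal (std_normal_density t) * indicator {x<..y} t \<partial>lborel)"
      by (subst emeasure_density) auto
    also have "\<dots> = (\<integral>\<^sup>+ t. ennreal (std_normal_density t) * indicator {x..y} t \<partial>lborel)"
      using AE_lborel_singleton[of x]
      by (intro nn_integral_cong_AE) (auto elim!: eventually_mono split: split_indicator)
    also have "\<dots> = F y - F x"
      using F that by (intro nn_integral_FTC_Icc) auto
    finally have "measure std_normal {x<..y} = F y - F x"
      using mono by (simp add: measure_def)
    moreover have "measure std_normal ({..y} - {..x}) = measure std_normal {..y} - measure std_normal {..x}"
      using that by (intro G.finite_measure_Diff) auto
    moreover have "{..y} - {..x} = {x<..y}"
      by auto
    ultimately show ?thesis
      by (simp add: T_def)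
  qed
  have T_eq: "T = (\<lambda>x. 2 * F x + (T 0 - 2 * F 0))"
  proof
    fix x show "T x = 2 * F x + (T 0 - 2 * F 0)"
      using diff[of x 0] diff[of 0 x] by (cases "x \<le> 0") auto
  qed
  have T: "(T has_real_derivative 2 * std_normal_density x) (at x)" for x
    by (subst T_eq) (auto intro!: derivative_eq_intros F)
  note [measurable] = borel_measurable_has_real_derivative[OF T]
  have T_range: "-1 \<le> T x" "T x \<le> 1" for x
    using G.prob_le_1[of "{..x}"] by (auto simp: T_def)
have "distr std_normal borel T = uniform"
  proof (rule prob_space_eqI_le)
    fix A assume "A \<in> sets (distr std_normal borel T)"
    then have [measurable]: "A \<in> sets borel" by simp
    \<comment> \<open>\<open>?f\<close> is the uniform density restricted to \<open>A\<close>. As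
      \<open>T\<close> takes values in \<open>{-1..1}\<close>, multiplying \<open>?f (T x)\<close>
      by the derivative of \<open>T\<close> gives exactly the Gaussian density on the preimage of
      \<open>A\<close>.\<close>
    let ?f = "\<lambda>x. indicator (A \<inter> {-1..1}) x / 2 :: real"
    have "emeasure (distr std_normal borel T) A = (\<integral>\<^sup>+ x. ennreal (std_normal_density x) * indicator (T -` A) x \<partial>lborel)"
      using measurable_sets[of T borel borel A]
      by (subst emeasure_distr, simp, simp, subst emeasure_density) auto
    also have "\<dots> = (\<integral>\<^sup>+ x. ennreal (?f (T x) * (2 * std_normal_density x)) \<partial>lborel)"
      using T_range by (intro nn_integral_cong) (auto split: split_indicator)
    also have "\<dots> \<le> (\<integral>\<^sup>+ x. ennreal (?f x) \<partial>lborel)"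
      using T by (intro nn_integral_substitution_le)
        (auto intro!: continuous_intros continuous_on_std_normal_density)
    also have "\<dots> = (\<integral>\<^sup>+ x. indicator A x * indicator {-1..1} x / 2 \<partial>lborel)"
      by (intro nn_integral_cong) (auto split: split_indicator simp: divide_ennreal[symmetric])
    also have "\<dots> = (\<integral>\<^sup>+ x. indicator A x \<partial>uniform)"
      by (subst nn_integral_uniform) (auto simp: nn_integral_divide)
    also have "\<dots> = emeasure uniform A"
      by (rule nn_integral_indicator) simp
    finally show "emeasure (distr std_normal borel T) A \<le> emeasure uniform A" .
  qed (auto intro: prob_space_uniform G.prob_space_distr)
  with T show ?thesis by blast
qed

section \<open>Sub-Gaussian bound for the uniform law\<close>

text \<open>Termwise comparison of power series: the coefficient of \<open>x ^ (2 * k + 1)\<close>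
  is \<open>1 / fact (2 * k + 1)\<close> on the left and \<open>1 / (6 ^ k * fact k)\<close> on the
  right. The induction in \<open>f\<close> rests on 2 k + 3 \<ge> 3.\<close>

lemma sinh_le: 
  fixes x :: real
  assumes "0 \<le> x"
  shows "sinh x \<le> x * exp (x\<^sup>2 / 6)"
proof -
  have f: "6 ^ k * fact k \<le> (fact (2 * k + 1) :: real)" for k :: nat
  proof (induction k)
    case (Suc k)
    have "6 ^ Suc k * fact (Suc k) = (6 * (real k + 1)) * (6 ^ k * fact k)"
      by simp
    also have "\<dots> \<le> ((2 * real k + 3) * (2 * real k + 2)) * fact (2 * k + 1)"
      by (rule mult_mono[OF _ Suc]) (simp_all add: algebra_simps)
    also have "\<dots> = fact (2 * Suc k + 1)"
      by (simp add: algebra_simps)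
    finally show ?case .
  qed simp
  have s: "(\<lambda>k. x ^ (2 * k + 1) / fact (2 * k + 1)) sums sinh x"
  proof -
    \<comment> \<open>The series in \<open>sinh_converges\<close> runs over all powers, with zero
      terms at even \<open>n\<close>; reindexing keeps the odd ones.\<close>
    have "(\<lambda>k. (\<lambda>n. if even n then 0 else x ^ n /\<^sub>R fact n) (2 * k + 1)) sums sinh x"
    proof (subst sums_mono_reindex)
      show "strict_mono (\<lambda>k::nat. 2 * k + 1)"
        by (simp add: strict_mono_def)
      show "(if even n then 0 else x ^ n /\<^sub>R fact n) = 0" if "n \<notin> range (\<lambda>k. 2 * k + 1)" for n
        using that by (metis oddE rangeI)
    qed (rule sinh_converges)
    moreover have "(if even (2 * k + 1) then 0 else x ^ (2 * k + 1) /\<^sub>R fact (2 * k + 1))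
        = x ^ (2 * k + 1) / fact (2 * k + 1)" for k :: nat
    proof -
      have "odd (2 * k + 1)" by simp
      then show ?thesis
        by (simp only: if_False real_scaleR_def divide_inverse mult.commute)
    qed
    ultimately show ?thesis
      by (simp only:)
  qed
  have e: "(\<lambda>k. x * ((x\<^sup>2 / 6) ^ k /\<^sub>R fact k)) sums (x * exp (x\<^sup>2 / 6))"
    by (intro sums_mult exp_converges)
  have le: "x ^ (2 * k + 1) / fact (2 * k + 1) \<le> x * ((x\<^sup>2 / 6) ^ k /\<^sub>R fact k)" for k
  proof -
    have "x ^ (2 * k + 1) / fact (2 * k + 1) \<le> x ^ (2 * k + 1) / (6 ^ k * fact k)"
      by (intro divide_left_mono f zero_le_power assms mult_pos_pos) simp_all
    also have "\<dots> = x * ((x\<^sup>2 / 6) ^ k /\<^sub>R fact k)"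
      by (simp only: power_add power_mult power_one_right power_divide) (simp add: field_simps)
    finally show ?thesis .
  qed
  show ?thesis
    by (rule sums_le[OF le s e])
qed

lemma uniform_mgf_le: "(\<integral>\<^sup>+ x. exp (r * x) \<partial>uniform) \<le> exp (r\<^sup>2 / 6)"
proof (cases "r = 0")
  case True
  interpret prob_space uniform by (rule prob_space_uniform)
  show ?thesis using True emeasure_space_1 by simp
next
  case False
  have "(\<integral>\<^sup>+ x. exp (r * x) \<partial>uniform) = (\<integral>\<^sup>+ x. ennreal (exp (r * x)) * indicator {-1..1} x \<partial>lborel) / 2"
    by (rule nn_integral_uniform) simp
  also have "(\<integral>\<^sup>+ x. ennreal (exp (r * x)) * indicator {-1..1} x \<partial>lborel) = exp (r * 1) / r - exp (r * (-1)) / r"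
    using False by (intro nn_integral_FTC_Icc) (auto intro!: derivative_eq_intros)
  \<comment> \<open>\<open>sinh r / r\<close> is even, so passing to the absolute value lets
    \<open>sinh_le\<close>, stated for nonnegative arguments, serve both signs of
    \<open>r\<close>.\<close>
  also have "exp (r * 1) / r - exp (r * (-1)) / r = 2 * (sinh \<bar>r\<bar> / \<bar>r\<bar>)"
  proof -
    have "sinh \<bar>r\<bar> / \<bar>r\<bar> = sinh r / r"
      by (cases "0 \<le> r") simp_all
    then show ?thesis
      by (simp add: sinh_field_def diff_divide_distrib)
  qed
  also have "ennreal (2 * (sinh \<bar>r\<bar> / \<bar>r\<bar>)) / 2 = ennreal (sinh \<bar>r\<bar> / \<bar>r\<bar>)"
    using divide_ennreal[of "2 * (sinh \<bar>r\<bar> / \<bar>r\<bar>)" 2] by simp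
  also have "\<dots> \<le> exp (r\<^sup>2 / 6)"
    using False sinh_le[of "\<bar>r\<bar>"] by (intro ennreal_leI) (simp add: divide_simps mult.commute)
  finally show ?thesis .
qed

section \<open>Gaussian product measures: translations and projection to a unit vector\<close>

lemma product_sigma_finite_prob:
  assumes "prob_space M" shows "product_sigma_finite (\<lambda>_. M)"
  using assms prob_space_imp_sigma_finite by (auto simp: product_sigma_finite_def)

lemma sets_PiM_std_normal [simp, measurable_cong]:
  "sets (\<Pi>\<^sub>M i\<in>I. std_normal) = sets (\<Pi>\<^sub>M i\<in>I. (borel :: real measure))"
  by (rule sets_PiM_cong) auto

text \<open>Completing the square, the factor \<open>exp (c * x - c\<^sup>2 / 2)\<close> turns the
  density \<phi>(x) into \<phi>(x - c); subtracting \<open>c\<close> then restores the original law.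
  Taking products over boxes identifies the whole measure. The restricted lambda keeps shifted
  points inside the product space.\<close>

lemma cameron_martin_PiM:
  fixes a :: "'i \<Rightarrow> real" and H :: "('i \<Rightarrow> real) \<Rightarrow> ennreal"
  assumes I: "finite I"
    and [measurable]: "H \<in> borel_measurable (\<Pi>\<^sub>M i\<in>I. borel)"
  shows "(\<integral>\<^sup>+ g. H g \<partial>(\<Pi>\<^sub>M i\<in>I. std_normal)) =
    (\<integral>\<^sup>+ g. exp (\<Sum>i\<in>I. a i * g i - (a i)\<^sup>2 / 2) * H (\<lambda>i\<in>I. g i - a i) \<partial>(\<Pi>\<^sub>M i\<in>I. std_normal))"
proof -
  interpret product_sigma_finite "\<lambda>_::'i. std_normal"
    by (rule product_sigma_finite_prob[OF prob_space_std_normal])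
  let ?P = "\<Pi>\<^sub>M i\<in>I. std_normal"
  let ?B = "\<Pi>\<^sub>M i\<in>I. (borel :: real measure)"
  let ?w = "\<lambda>g. ennreal (exp (\<Sum>i\<in>I. a i * g i - (a i)\<^sup>2 / 2))"
  let ?s = "\<lambda>g. \<lambda>i\<in>I. g i - a i"
  have [measurable]: "?w \<in> borel_measurable ?B" "?s \<in> measurable ?B ?B"
    by measurable
  have eq: "distr (density ?P ?w) ?B ?s = ?P"
  proof (rule PiM_eqI[OF I])
    fix A assume "\<And>i. i \<in> I \<Longrightarrow> A i \<in> sets std_normal"
    then have A [measurable]: "i \<in> I \<Longrightarrow> A i \<in> sets borel" for i by simp
    have [measurable]: "Pi\<^sub>E I A \<in> sets ?B"
      using A I by (intro sets_PiM_I_finite) auto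
    have one: "(\<integral>\<^sup>+ x. ennreal (exp (c * x - c\<^sup>2 / 2)) * indicator S (x - c) \<partial>std_normal) = emeasure std_normal S"
      if [measurable]: "S \<in> sets borel" for c S
    proof -
      have "(\<integral>\<^sup>+ x. ennreal (exp (c * x - c\<^sup>2 / 2)) * indicator S (x - c) \<partial>std_normal)
        = (\<integral>\<^sup>+ x. ennreal (std_normal_density x) * (ennreal (exp (c * x - c\<^sup>2 / 2)) * indicator S (x - c)) \<partial>lborel)"
        by (subst nn_integral_density) auto
      also have "\<dots> = (\<integral>\<^sup>+ x. ennreal (std_normal_density (x - c)) * indicator S (x - c) \<partial>lborel)"
        by (intro nn_integral_cong)
          (auto simp: std_normal_density_def ennreal_mult[symmetric] exp_add[symmetric] power2_eq_square field_simps
            split: split_indicator)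
      also have "\<dots> = (\<integral>\<^sup>+ x. ennreal (std_normal_density x) * indicator S x \<partial>lborel)"
        by (subst nn_integral_real_affine[where c=1 and t="-c", of "\<lambda>x. ennreal (std_normal_density x) * indicator S x"])
          auto
      also have "\<dots> = emeasure std_normal S"
        by (subst emeasure_density) auto
      finally show ?thesis .
    qed
    have "emeasure (distr (density ?P ?w) ?B ?s) (Pi\<^sub>E I A)
      = (\<integral>\<^sup>+ g. indicator (Pi\<^sub>E I A) g \<partial>distr (density ?P ?w) ?B ?s)"
      by simp
    also have "\<dots> = (\<integral>\<^sup>+ g. ?w g * indicator (Pi\<^sub>E I A) (?s g) \<partial>?P)"
      by (subst nn_integral_distr, simp, simp, subst nn_integral_density) auto
    also have "\<dots> = (\<integral>\<^sup>+ g. (\<Prod>i\<in>I. ennreal (exp (a i * g i - (a i)\<^sup>2 / 2)) * indicator (A i) (g i - a i)) \<partial>?P)"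
    proof (intro nn_integral_cong)
      fix g
      have "?w g = (\<Prod>i\<in>I. ennreal (exp (a i * g i - (a i)\<^sup>2 / 2)))"
        using I by (simp add: exp_sum prod_ennreal)
      moreover have "indicator (Pi\<^sub>E I A) (?s g) = (\<Prod>i\<in>I. indicator (A i) (g i - a i) :: ennreal)"
      proof (cases "\<forall>i\<in>I. g i - a i \<in> A i")
        case False
        then have "(\<Prod>i\<in>I. indicator (A i) (g i - a i) :: ennreal) = 0"
          using I by (intro prod_zero) (auto simp: indicator_def)
        with False show ?thesis by (auto simp: PiE_iff)
      qed (auto simp: PiE_iff)
      ultimately show "?w g * indicator (Pi\<^sub>E I A) (?s g) =
          (\<Prod>i\<in>I. ennreal (exp (a i * g i - (a i)\<^sup>2 / 2)) * indicator (A i) (g i - a i))"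
        by (simp only: prod.distrib)
    qed
    also have "\<dots> = (\<Prod>i\<in>I. emeasure std_normal (A i))"
      using A by (subst product_nn_integral_prod[OF I]) (auto intro!: prod.cong one)
    finally show "emeasure (distr (density ?P ?w) ?B ?s) (Pi\<^sub>E I A) = (\<Prod>i\<in>I. emeasure std_normal (A i))" .
  qed simp
  have "(\<integral>\<^sup>+ g. H g \<partial>?P) = (\<integral>\<^sup>+ g. H g \<partial>distr (density ?P ?w) ?B ?s)"
    by (simp only: eq)
  also have "\<dots> = (\<integral>\<^sup>+ g. ?w g * H (?s g) \<partial>?P)"
    by (subst nn_integral_distr, simp, simp, subst nn_integral_density) auto
  finally show ?thesis .
qed

lemma prob_space_PiM_std_normal: "prob_space (\<Pi>\<^sub>M i\<in>I. std_normal)"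
  by (intro prob_space_PiM prob_space_std_normal)

lemma nn_integral_std_normal_density_shift:
  "(\<integral>\<^sup>+ s. std_normal_density (c - s) \<partial>lborel) = 1"
proof -
  have "(\<integral>\<^sup>+ s. std_normal_density (c - s) \<partial>lborel) = (\<integral>\<^sup>+ s. std_normal_density s \<partial>lborel)"
    by (subst nn_integral_real_affine[where c="-1" and t=c, of "\<lambda>x. ennreal (std_normal_density x)"]) auto
  also have "\<dots> = emeasure std_normal (space std_normal)"
    by (subst emeasure_density) auto
  also have "\<dots> = 1"
    by (rule prob_space.emeasure_space_1[OF prob_space_std_normal])
  finally show ?thesis .
qed

text \<open>The weight \<open>exp (\<langle>a, g\<rangle>\<^sup>2 / 2)\<close> makes the Gaussian measure invariant under translations along \<open>a\<close>.
  Smearing with \<open>\<phi> (\<langle>a, g\<rangle> - s)\<close>, which integrates to 1 in \<open>s\<close>, and translating by \<open>s a\<close> leaves for each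
  \<open>g\<close> a one-dimensional substitution along the line \<open>g + s a\<close>.\<close>

lemma transport_density_bound:
  fixes a :: "'i \<Rightarrow> real" and T t f :: "real \<Rightarrow> real"
  assumes I: "finite I" and a: "(\<Sum>i\<in>I. (a i)\<^sup>2) = 1"
    and T: "\<And>x. (T has_real_derivative t x) (at x)"
    and t: "continuous_on UNIV t" "\<And>x. 0 \<le> t x"
    and f [measurable]: "f \<in> borel_measurable borel" and f0: "\<And>x. 0 \<le> f x"
  shows "(\<integral>\<^sup>+ g. f (\<Sum>i\<in>I. a i * T (g i)) * (\<Sum>i\<in>I. (a i)\<^sup>2 * t (g i)) *
      (sqrt (2 * pi) * exp ((\<Sum>i\<in>I. a i * g i)\<^sup>2 / 2)) \<partial>(\<Pi>\<^sub>M i\<in>I. std_normal))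
    \<le> (\<integral>\<^sup>+ x. f x \<partial>lborel)"
proof -
  let ?P = "\<Pi>\<^sub>M i\<in>I. std_normal"
  interpret P: prob_space ?P
    by (rule prob_space_PiM_std_normal)
  interpret pair_sigma_finite ?P lborel
    by standard
  have [measurable]: "t \<in> borel_measurable borel"
    by (rule borel_measurable_continuous_onI[OF t(1)])
  note [measurable] = borel_measurable_has_real_derivative[OF T]
  \<comment> \<open>\<open>K g\<close> is 1 / \<phi>(\<open>L g\<close>), and \<open>F\<close> is
    \<open>f\<close> at the transported sum times the derivative of that sum along
    \<open>a\<close>.\<close>
  define L where "L g = (\<Sum>i\<in>I. a i * g i)" for g
  define F where "F g = f (\<Sum>i\<in>I. a i * T (g i)) * (\<Sum>i\<in>I. (a i)\<^sup>2 * t (g i))" for g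
  define K where "K g = sqrt (2 * pi) * exp ((L g)\<^sup>2 / 2)" for g
  let ?sh = "\<lambda>s g. \<lambda>i\<in>I. g i + s * a i"
  have F0: "0 \<le> F g" and K0: "0 \<le> K g" for g
    using f0 t by (auto simp: F_def K_def intro!: mult_nonneg_nonneg sum_nonneg)
  have [measurable]: "L \<in> borel_measurable (\<Pi>\<^sub>M i\<in>I. borel)" "F \<in> borel_measurable (\<Pi>\<^sub>M i\<in>I. borel)"
    "K \<in> borel_measurable (\<Pi>\<^sub>M i\<in>I. borel)"
    unfolding L_def F_def K_def by measurable
  \<comment> \<open>This is where the unit length of \<open>a\<close> enters.\<close>
  have L_sh: "L (?sh s g) = L g + s" for s g
    using a by (simp add: L_def algebra_simps sum.distrib sum_distrib_left[symmetric] power2_eq_square)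
  \<comment> \<open>Cameron-Martin with the vector \<open>- s * a i\<close>: its factor is the
    inverse of \<open>K (?sh s g) * std_normal_density (L g)\<close>, so only the translated
    \<open>F\<close> remains.\<close>
  have inner: "(\<integral>\<^sup>+ g. ennreal (F g * K g * std_normal_density (L g - s)) \<partial>?P) = (\<integral>\<^sup>+ g. F (?sh s g) \<partial>?P)" for s
  proof -
    have "(\<integral>\<^sup>+ g. ennreal (F g * K g * std_normal_density (L g - s)) \<partial>?P)
      = (\<integral>\<^sup>+ g. exp (\<Sum>i\<in>I. (- s * a i) * g i - (- s * a i)\<^sup>2 / 2) *
         ennreal (F (\<lambda>i\<in>I. g i - (- s * a i)) * K (\<lambda>i\<in>I. g i - (- s * a i)) *
         std_normal_density (L (\<lambda>i\<in>I. g i - (- s * a i)) - s)) \<partial>?P)"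
      by (rule cameron_martin_PiM[OF I]) measurable
    also have "\<dots> = (\<integral>\<^sup>+ g. F (?sh s g) \<partial>?P)"
    proof (intro nn_integral_cong)
      fix g
      have "(\<Sum>i\<in>I. (- s * a i) * g i - (- s * a i)\<^sup>2 / 2) = - s * L g - s\<^sup>2 / 2 * (\<Sum>i\<in>I. (a i)\<^sup>2)"
        by (simp add: L_def sum_subtractf sum_distrib_left power_mult_distrib sum_negf mult_ac sum_divide_distrib)
      then have w: "(\<Sum>i\<in>I. (- s * a i) * g i - (- s * a i)\<^sup>2 / 2) = - s * L g - s\<^sup>2 / 2"
        using a by simp
      have "K (?sh s g) * std_normal_density (L g) = exp ((L g + s)\<^sup>2 / 2 + - (L g)\<^sup>2 / 2)"
        by (simp only: K_def L_sh std_normal_density_def exp_add) simp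
      moreover have "- s * L g - s\<^sup>2 / 2 + ((L g + s)\<^sup>2 / 2 + - (L g)\<^sup>2 / 2) = 0"
        by (simp add: power2_eq_square field_simps)
      ultimately have one: "exp (- s * L g - s\<^sup>2 / 2) * (K (?sh s g) * std_normal_density (L g)) = 1"
        by (simp only: exp_add[symmetric] exp_zero)
      have "exp (- s * L g - s\<^sup>2 / 2) * (F (?sh s g) * K (?sh s g) * std_normal_density (L g)) = F (?sh s g)"
      proof -
        have "exp (- s * L g - s\<^sup>2 / 2) * (F (?sh s g) * K (?sh s g) * std_normal_density (L g))
            = F (?sh s g) * (exp (- s * L g - s\<^sup>2 / 2) * (K (?sh s g) * std_normal_density (L g)))"
          by (simp only: mult_ac)
        then show ?thesis
          by (simp only: one mult_1_right)
      qed
      then show "ennreal (exp (\<Sum>i\<in>I. (- s * a i) * g i - (- s * a i)\<^sup>2 / 2)) *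
         ennreal (F (\<lambda>i\<in>I. g i - (- s * a i)) * K (\<lambda>i\<in>I. g i - (- s * a i)) *
         std_normal_density (L (\<lambda>i\<in>I. g i - (- s * a i)) - s)) = ennreal (F (?sh s g))"
        unfolding w by (simp add: L_sh ennreal_mult[symmetric] F0 K0)
    qed
    finally show ?thesis .
  qed
  \<comment> \<open>On the line through \<open>g\<close>, the second factor of \<open>F\<close> is
    the derivative in \<open>s\<close> of the argument of \<open>f\<close>, so the one-dimensional
    substitution applies.\<close>
  have outer: "(\<integral>\<^sup>+ s. F (?sh s g) \<partial>lborel) \<le> (\<integral>\<^sup>+ x. f x \<partial>lborel)" for g
  proof -
    have "(\<integral>\<^sup>+ s. F (?sh s g) \<partial>lborel) = (\<integral>\<^sup>+ s. ennreal (f (\<Sum>i\<in>I. a i * T (g i + s * a i)) *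
        (\<Sum>i\<in>I. (a i)\<^sup>2 * t (g i + s * a i))) \<partial>lborel)"
      by (simp add: F_def)
    also have "\<dots> \<le> (\<integral>\<^sup>+ x. f x \<partial>lborel)"
    proof (rule nn_integral_substitution_le[OF f])
      show "((\<lambda>s. \<Sum>i\<in>I. a i * T (g i + s * a i)) has_real_derivative (\<Sum>i\<in>I. (a i)\<^sup>2 * t (g i + s * a i))) (at s)" for s
        by (auto intro!: derivative_eq_intros DERIV_chain2[OF T] sum.cong simp: power2_eq_square)
      show "continuous_on UNIV (\<lambda>s. \<Sum>i\<in>I. (a i)\<^sup>2 * t (g i + s * a i))"
        by (intro continuous_intros continuous_on_compose2[OF t(1)]) auto
    qed (use t f0 in \<open>auto intro!: sum_nonneg\<close>)
    finally show ?thesis .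
  qed
  have "(\<integral>\<^sup>+ g. F g * K g \<partial>?P) = (\<integral>\<^sup>+ g. \<integral>\<^sup>+ s. ennreal (F g * K g * std_normal_density (L g - s)) \<partial>lborel \<partial>?P)"
    by (intro nn_integral_cong)
      (simp add: ennreal_mult F0 K0 nn_integral_cmult nn_integral_std_normal_density_shift)
  also have "\<dots> = (\<integral>\<^sup>+ s. \<integral>\<^sup>+ g. ennreal (F g * K g * std_normal_density (L g - s)) \<partial>?P \<partial>lborel)"
    by (rule Fubini'[symmetric]) measurable
  also have "\<dots> = (\<integral>\<^sup>+ s. \<integral>\<^sup>+ g. ennreal (F (?sh s g)) \<partial>?P \<partial>lborel)"
    by (simp only: inner)
  also have "\<dots> = (\<integral>\<^sup>+ g. \<integral>\<^sup>+ s. ennreal (F (?sh s g)) \<partial>lborel \<partial>?P)"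
    by (rule Fubini') measurable
  also have "\<dots> \<le> (\<integral>\<^sup>+ g. (\<integral>\<^sup>+ x. f x \<partial>lborel) \<partial>?P)"
    by (intro nn_integral_mono outer)
  also have "\<dots> = (\<integral>\<^sup>+ x. f x \<partial>lborel)"
    by (simp add: P.emeasure_space_1)
  finally show ?thesis
    by (simp add: F_def K_def L_def)
qed

lemma distr_PiM_std_normal_linear:
  fixes a :: "'i \<Rightarrow> real"
  assumes I: "finite I" and a: "(\<Sum>i\<in>I. (a i)\<^sup>2) = 1"
  shows "distr (\<Pi>\<^sub>M i\<in>I. std_normal) borel (\<lambda>g. \<Sum>i\<in>I. a i * g i) = std_normal"
proof (rule prob_space_eqI_le)
  let ?P = "\<Pi>\<^sub>M i\<in>I. std_normal"
  interpret P: prob_space ?P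
    by (rule prob_space_PiM_std_normal)
  show "prob_space (distr ?P borel (\<lambda>g. \<Sum>i\<in>I. a i * g i))"
    by (rule P.prob_space_distr) measurable
  fix A assume "A \<in> sets (distr ?P borel (\<lambda>g. \<Sum>i\<in>I. a i * g i))"
  then have [measurable]: "A \<in> sets borel" by simp
  \<comment> \<open>The weight is the reciprocal of the density, so the test function
    \<open>indicator A x * std_normal_density x\<close> reduces the transported integrand to the
    indicator.\<close>
  have K: "std_normal_density x * (sqrt (2 * pi) * exp (x\<^sup>2 / 2)) = 1" for x
    by (simp add: std_normal_density_def exp_minus)
  have "emeasure (distr ?P borel (\<lambda>g. \<Sum>i\<in>I. a i * g i)) A
      = (\<integral>\<^sup>+ x. indicator A x \<partial>distr ?P borel (\<lambda>g. \<Sum>i\<in>I. a i * g i))"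
    by (rule nn_integral_indicator[symmetric]) simp
  also have "\<dots> = (\<integral>\<^sup>+ g. indicator A (\<Sum>i\<in>I. a i * g i) \<partial>?P)"
    by (rule nn_integral_distr) measurable
  \<comment> \<open>\<open>transport_density_bound\<close> for \<open>T = id\<close>; a one-sided bound suffices for probability measures.\<close>
  also have "\<dots> = (\<integral>\<^sup>+ g. (\<lambda>x. indicator A x * std_normal_density x) (\<Sum>i\<in>I. a i * id (g i)) *
      (\<Sum>i\<in>I. (a i)\<^sup>2 * 1) * (sqrt (2 * pi) * exp ((\<Sum>i\<in>I. a i * g i)\<^sup>2 / 2)) \<partial>?P)"
    using K a by (intro nn_integral_cong) (auto simp: mult.assoc split: split_indicator)
  also have "\<dots> \<le> (\<integral>\<^sup>+ x. indicator A x * std_normal_density x \<partial>lborel)"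
    by (rule transport_density_bound[OF I a]) auto
  also have "\<dots> = (\<integral>\<^sup>+ x. ennreal (std_normal_density x) * indicator A x \<partial>lborel)"
    by (intro nn_integral_cong) (auto split: split_indicator)
  also have "\<dots> = emeasure std_normal A"
    by (rule emeasure_density[symmetric]) auto
  finally show "emeasure (distr ?P borel (\<lambda>g. \<Sum>i\<in>I. a i * g i)) A \<le> emeasure std_normal A" .
qed (auto intro: prob_space_std_normal)

section \<open>Second moment, coordinatewise push-forward and convexity inequalities\<close>

lemma nn_integral_std_normal_square: "(\<integral>\<^sup>+ x. x\<^sup>2 \<partial>std_normal) = 1"
proof -
  have "(\<integral>\<^sup>+ x. x\<^sup>2 \<partial>std_normal) = (\<integral>\<^sup>+ x. ennreal (std_normal_density x * x\<^sup>2) \<partial>lborel)"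
    by (subst nn_integral_density) (auto simp: ennreal_mult)
  also have "\<dots> = ennreal (\<integral> x. std_normal_density x * x\<^sup>2 \<partial>lborel)"
    using integrable_std_normal_moment[of 2] by (intro nn_integral_eq_integral) auto
  also have "(\<integral> x. std_normal_density x * x\<^sup>2 \<partial>lborel) = 1"
    using integral_std_normal_moment_even[of 1] by simp
  finally show ?thesis by simp
qed

lemma PiM_uniform_eq_distr:
  assumes I: "finite I" and T: "distr std_normal borel T = uniform"
    and [measurable]: "T \<in> borel_measurable borel"
  shows "(\<Pi>\<^sub>M i\<in>I. uniform) = distr (\<Pi>\<^sub>M i\<in>I. std_normal) (\<Pi>\<^sub>M i\<in>I. borel) (compose I T)"
proof -
  have "distr (\<Pi>\<^sub>M i\<in>I. std_normal) (\<Pi>\<^sub>M i\<in>I. uniform) (compose I T) = (\<Pi>\<^sub>M i\<in>I. distr std_normal uniform T)"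
    by (intro distr_PiM_finite_prob_space' I prob_space_std_normal prob_space_uniform) simp
  also have "distr std_normal uniform T = uniform"
    by (subst T[symmetric]) (rule distr_cong, auto)
  finally show ?thesis
    by (metis (no_types, lifting) distr_cong sets_PiM_cong sets_uniform_measure sets_lborel)
qed

text \<open>Jensen's inequality, from the tangent line of \<open>exp\<close> at the weighted mean
  \<open>m\<close>, whose linear part averages to zero. It is applied with the weights
  \<open>(a i)\<^sup>2\<close>.\<close>

lemma exp_weighted_sum_le:
  fixes w x :: "'i \<Rightarrow> real"
  assumes "(\<Sum>i\<in>I. w i) = 1" "\<And>i. i \<in> I \<Longrightarrow> 0 \<le> w i"
  shows "exp (\<Sum>i\<in>I. w i * x i) \<le> (\<Sum>i\<in>I. w i * exp (x i))"
proof -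
  define m where "m = (\<Sum>i\<in>I. w i * x i)"
  have "exp m = exp m * (\<Sum>i\<in>I. w i * (1 + (x i - m)))"
    using assms(1) by (simp add: algebra_simps sum.distrib sum_subtractf sum_distrib_left[symmetric] m_def[symmetric])
  also have "\<dots> \<le> exp m * (\<Sum>i\<in>I. w i * exp (x i - m))"
    by (intro mult_left_mono sum_mono assms exp_ge_add_one_self) auto
  also have "\<dots> = (\<Sum>i\<in>I. w i * exp (x i))"
    by (simp add: sum_distrib_left exp_diff)
  finally show ?thesis by (simp add: m_def)
qed

text \<open>The right side is the tangent line at \<open>y\<close> of the concave function
  \<open>x powr p\<close>. It follows from the weighted arithmetic-geometric mean inequality for
  \<open>x / y\<close> and 1.\<close>

lemma powr_le_affine:
  fixes x y p :: real
  assumes "0 \<le> x" "0 < y" "0 < p" "p < 1"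
  shows "x powr p \<le> (1 - p) * y powr p + p * (x * y powr (p - 1))"
proof (cases "x = 0")
  case False
  with assms have "(x / y) powr p * 1 powr (1 - p) \<le> p * (x / y) + (1 - p) * 1"
    by (intro Youngs_inequality_0) auto
  then have "(x / y) powr p * y powr p \<le> (p * (x / y) + (1 - p)) * y powr p"
    by (intro mult_right_mono) auto
  moreover have "(x / y) powr p * y powr p = x powr p"
    using assms by (simp add: powr_divide)
  moreover have "(p * (x / y) + (1 - p)) * y powr p = (1 - p) * y powr p + p * (x * y powr (p - 1))"
    using assms by (simp add: powr_diff algebra_simps)
  ultimately show ?thesis by simp
qed (use assms in simp)

section \<open>The Gaussian upper bound\<close>

lemma std_normal_mgf: "(\<integral>\<^sup>+ t. exp (b * t) \<partial>std_normal) = exp (b\<^sup>2 / 2)"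
proof -
  have "(\<integral>\<^sup>+ t. exp (b * t) \<partial>std_normal) = (\<integral>\<^sup>+ t. ennreal (std_normal_density t) * ennreal (exp (b * t)) \<partial>lborel)"
    by (subst nn_integral_density) auto
  also have "\<dots> = (\<integral>\<^sup>+ t. ennreal (exp (b\<^sup>2 / 2)) * ennreal (std_normal_density (b - t)) \<partial>lborel)"
  proof (intro nn_integral_cong)
    fix t
    have "std_normal_density t * exp (b * t) = 1 / sqrt (2 * pi) * exp (- t\<^sup>2 / 2 + b * t)"
      by (simp only: std_normal_density_def exp_add mult.assoc)
    also have "- t\<^sup>2 / 2 + b * t = b\<^sup>2 / 2 + - (b - t)\<^sup>2 / 2"
      by (simp add: power2_eq_square field_simps)
    also have "1 / sqrt (2 * pi) * exp (b\<^sup>2 / 2 + - (b - t)\<^sup>2 / 2) = exp (b\<^sup>2 / 2) * std_normal_density (b - t)"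
      by (simp only: std_normal_density_def exp_add mult_ac)
    finally show "ennreal (std_normal_density t) * ennreal (exp (b * t)) = ennreal (exp (b\<^sup>2 / 2)) * ennreal (std_normal_density (b - t))"
      by (simp add: ennreal_mult[symmetric])
  qed
  also have "\<dots> = exp (b\<^sup>2 / 2)"
    by (simp add: nn_integral_cmult nn_integral_std_normal_density_shift)
  finally show ?thesis .
qed

lemma distr_std_normal_scale:
  assumes "0 < \<sigma>"
  shows "distr std_normal borel (\<lambda>x. \<sigma> * x) = density lborel (normal_density 0 \<sigma>)"
proof -
  interpret prob_space std_normal by (rule prob_space_std_normal)
  have "distributed std_normal lborel (\<lambda>x. x) std_normal_density"
    by (auto simp: distributed_def intro!: measure_eqI emeasure_distr[THEN trans])
  from normal_density_affine[OF this, of \<sigma> 0] assms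
  show ?thesis
    by (simp add: distributed_def) (metis distr_cong sets_lborel)
qed

text \<open>\<open>exp (c * x\<^sup>2 / 2)\<close> is the Gaussian average over \<open>t\<close> of
  \<open>exp (sqrt c * t * x)\<close>. After exchanging the integrals, \<open>mgf\<close> applies
  with \<open>r = sqrt c * t\<close> for each \<open>t\<close>.\<close>

lemma nn_integral_exp_square_mono:
  assumes M: "prob_space M" "sets M = sets borel" and N: "prob_space N" "sets N = sets borel"
    and mgf: "\<And>r::real. (\<integral>\<^sup>+ x. exp (r * x) \<partial>M) \<le> (\<integral>\<^sup>+ x. exp (r * x) \<partial>N)"
    and c: "0 \<le> c"
  shows "(\<integral>\<^sup>+ x. exp (c * x\<^sup>2 / 2) \<partial>M) \<le> (\<integral>\<^sup>+ x. exp (c * x\<^sup>2 / 2) \<partial>N)"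
proof -
  have eq: "(\<integral>\<^sup>+ x. exp (c * x\<^sup>2 / 2) \<partial>L) = (\<integral>\<^sup>+ t. \<integral>\<^sup>+ x. exp (sqrt c * t * x) \<partial>L \<partial>std_normal)"
    if "prob_space L" and [measurable_cong]: "sets L = sets borel" for L :: "real measure"
  proof -
    interpret L: prob_space L by fact
    interpret G: prob_space std_normal by (rule prob_space_std_normal)
    interpret pair_sigma_finite L std_normal by standard
    have "(\<integral>\<^sup>+ x. exp (c * x\<^sup>2 / 2) \<partial>L) = (\<integral>\<^sup>+ x. \<integral>\<^sup>+ t. exp (sqrt c * x * t) \<partial>std_normal \<partial>L)"
      using c by (simp add: std_normal_mgf power_mult_distrib)
    also have "\<dots> = (\<integral>\<^sup>+ t. \<integral>\<^sup>+ x. exp (sqrt c * x * t) \<partial>L \<partial>std_normal)"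
      by (rule Fubini'[symmetric]) measurable
    finally show ?thesis
      by (simp add: mult_ac)
  qed
  show ?thesis
    unfolding eq[OF M] eq[OF N] by (intro nn_integral_mono mgf)
qed

lemma nn_integral_powr_le_normal:
  fixes f :: "real \<Rightarrow> real"
  assumes f [measurable]: "f \<in> borel_measurable borel" and f0: "\<And>x. 0 \<le> f x"
    and prob: "prob_space (density lborel f)" and \<sigma>: "0 < \<sigma>"
    and mgf: "\<And>r. (\<integral>\<^sup>+ x. exp (r * x) \<partial>density lborel f) \<le> exp (\<sigma>\<^sup>2 * r\<^sup>2 / 2)"
    and p: "0 < p" "p < 1"
  shows "(\<integral>\<^sup>+ x. f x powr p \<partial>lborel) \<le> (\<integral>\<^sup>+ x. normal_density 0 \<sigma> x powr p \<partial>lborel)"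
proof -
  let ?g = "normal_density 0 \<sigma>"
  let ?G = "density lborel ?g"
  \<comment> \<open>Both constants are read off from \<open>?g x powr (p - 1)\<close>. Since p - 1
    is negative, the Gaussian exponent changes sign and \<open>c\<close> is nonnegative, as
    \<open>nn_integral_exp_square_mono\<close> requires.\<close>
  define C where "C = (1 / sqrt (2 * pi * \<sigma>\<^sup>2)) powr (p - 1)"
  define c where "c = (1 - p) / \<sigma>\<^sup>2"
  have C0: "0 \<le> C" and c0: "0 \<le> c"
    using p by (auto simp: C_def c_def)
  have g0: "0 < ?g x" for x
    using \<sigma> by (rule normal_density_pos)
  have g_powr: "?g x powr (p - 1) = C * exp (c * x\<^sup>2 / 2)" for x
  proof -
    have "?g x powr (p - 1) = C * exp (- (x - 0)\<^sup>2 / (2 * \<sigma>\<^sup>2)) powr (p - 1)"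
      unfolding normal_density_def C_def by (rule powr_mult)
    also have "exp (- (x - 0)\<^sup>2 / (2 * \<sigma>\<^sup>2)) powr (p - 1) = exp (c * x\<^sup>2 / 2)"
      using \<sigma> by (simp add: powr_def c_def field_simps)
    finally show ?thesis .
  qed
  have mgf_g: "(\<integral>\<^sup>+ x. exp (r * x) \<partial>?G) = exp (\<sigma>\<^sup>2 * r\<^sup>2 / 2)" for r
    by (subst distr_std_normal_scale[OF \<sigma>, symmetric], subst nn_integral_distr)
      (use std_normal_mgf[of "r * \<sigma>"] in \<open>simp_all add: power_mult_distrib mult_ac\<close>)
  have "(\<integral>\<^sup>+ x. exp (c * x\<^sup>2 / 2) \<partial>density lborel f) \<le> (\<integral>\<^sup>+ x. exp (c * x\<^sup>2 / 2) \<partial>?G)"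
    using mgf mgf_g c0 \<sigma> by (intro nn_integral_exp_square_mono prob prob_space_normal_density) auto
  \<comment> \<open>Stated for general \<open>h\<close> because it serves both \<open>f\<close> and
    \<open>?g\<close>, turning the comparison of exponential squares into one of the integrals
    against \<open>?g x powr (p - 1)\<close>.\<close>
  moreover have weighted: "(\<integral>\<^sup>+ x. h x * ?g x powr (p - 1) \<partial>lborel)
      = ennreal C * (\<integral>\<^sup>+ x. exp (c * x\<^sup>2 / 2) \<partial>density lborel h)"
    if [measurable]: "h \<in> borel_measurable borel" and "\<And>x. 0 \<le> h x" for h :: "real \<Rightarrow> real"
  proof -
    have "ennreal C * (\<integral>\<^sup>+ x. exp (c * x\<^sup>2 / 2) \<partial>density lborel h)
        = (\<integral>\<^sup>+ x. ennreal C * (ennreal (h x) * ennreal (exp (c * x\<^sup>2 / 2))) \<partial>lborel)"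
      by (subst nn_integral_density) (auto simp: nn_integral_cmult)
    also have "\<dots> = (\<integral>\<^sup>+ x. h x * ?g x powr (p - 1) \<partial>lborel)"
      using that C0 by (intro nn_integral_cong) (simp add: g_powr ennreal_mult[symmetric] mult_ac)
    finally show ?thesis ..
  qed
  ultimately have "(\<integral>\<^sup>+ x. f x * ?g x powr (p - 1) \<partial>lborel) \<le> (\<integral>\<^sup>+ x. ?g x * ?g x powr (p - 1) \<partial>lborel)"
    using weighted[OF f f0] weighted[of ?g] by (simp add: mult_left_mono)
  also have "\<dots> = (\<integral>\<^sup>+ x. ?g x powr p \<partial>lborel)"
    using g0 by (intro nn_integral_cong) (simp add: powr_diff less_imp_neq[symmetric])
  finally have le: "(\<integral>\<^sup>+ x. f x * ?g x powr (p - 1) \<partial>lborel) \<le> (\<integral>\<^sup>+ x. ?g x powr p \<partial>lborel)" .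
  \<comment> \<open>Integrate the tangent bound at \<open>?g x\<close>; by \<open>le\<close> its two
    terms contribute at most the shares 1 - p and p of the same Gaussian integral.\<close>
  have "(\<integral>\<^sup>+ x. f x powr p \<partial>lborel) \<le> (\<integral>\<^sup>+ x. (1 - p) * ?g x powr p + p * (f x * ?g x powr (p - 1)) \<partial>lborel)"
    using f0 g0 p by (intro nn_integral_mono ennreal_leI powr_le_affine)
  also have "\<dots> = (\<integral>\<^sup>+ x. ennreal (1 - p) * ennreal (?g x powr p) + ennreal p * ennreal (f x * ?g x powr (p - 1)) \<partial>lborel)"
    using f0 p by (intro nn_integral_cong) (simp add: ennreal_mult ennreal_plus)
  also have "\<dots> = ennreal (1 - p) * (\<integral>\<^sup>+ x. ?g x powr p \<partial>lborel) + ennreal p * (\<integral>\<^sup>+ x. f x * ?g x powr (p - 1) \<partial>lborel)"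
    by (subst nn_integral_add) (auto simp: nn_integral_cmult)
  also have "\<dots> \<le> ennreal (1 - p) * (\<integral>\<^sup>+ x. ?g x powr p \<partial>lborel) + ennreal p * (\<integral>\<^sup>+ x. ?g x powr p \<partial>lborel)"
    by (intro add_left_mono mult_left_mono le) simp
  also have "\<dots> = (\<integral>\<^sup>+ x. ?g x powr p \<partial>lborel)"
    using p by (simp add: distrib_right[symmetric] ennreal_plus[symmetric] del: ennreal_plus)
  finally show ?thesis .
qed

section \<open>Absolute continuity of the sum and the uniform lower bound\<close>

lemma nn_integral_PiM_uniform_transport:
  fixes a :: "'i \<Rightarrow> real" and h :: "real \<Rightarrow> ennreal"
  assumes I: "finite I" and T: "distr std_normal borel T = uniform"
    and [measurable]: "T \<in> borel_measurable borel" "h \<in> borel_measurable borel"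
  shows "(\<integral>\<^sup>+ u. h (\<Sum>i\<in>I. a i * u i) \<partial>(\<Pi>\<^sub>M i\<in>I. uniform)) =
    (\<integral>\<^sup>+ g. h (\<Sum>i\<in>I. a i * T (g i)) \<partial>(\<Pi>\<^sub>M i\<in>I. std_normal))"
proof -
  have [measurable]: "compose I T \<in> measurable (\<Pi>\<^sub>M i\<in>I. std_normal) (\<Pi>\<^sub>M i\<in>I. borel)"
    unfolding compose_def by measurable
  show ?thesis
    by (subst PiM_uniform_eq_distr[OF I T], measurable, subst nn_integral_distr, measurable)
      (simp add: compose_def)
qed

text \<open>In \<open>transport_density_bound\<close> with the indicator of \<open>A\<close> as
  \<open>f\<close>, the right side is zero, while the Jacobian \<open>?D\<close> and the Gaussian
  weight are strictly positive. Hence the transported sum almost surely avoids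
  \<open>A\<close>.\<close>

lemma uniform_sum_absolutely_continuous:
  fixes a :: "'i \<Rightarrow> real"
  assumes I: "finite I" and a: "(\<Sum>i\<in>I. (a i)\<^sup>2) = 1" and A: "A \<in> null_sets lborel"
  shows "(\<integral>\<^sup>+ u. indicator A (\<Sum>i\<in>I. a i * u i) \<partial>(\<Pi>\<^sub>M i\<in>I. uniform)) = 0"
proof -
  obtain T where T: "\<And>x. (T has_real_derivative 2 * std_normal_density x) (at x)"
    and uni: "distr std_normal borel T = uniform"
    using std_normal_uniform_transport by blast
  note [measurable] = borel_measurable_has_real_derivative[OF T]
  have [measurable]: "A \<in> sets borel" using A by auto
  let ?P = "\<Pi>\<^sub>M i\<in>I. std_normal"
  let ?D = "\<lambda>g. \<Sum>i\<in>I. (a i)\<^sup>2 * (2 * std_normal_density (g i))"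
  have D: "0 < ?D g" for g
  proof -
    obtain i where "i \<in> I" "a i \<noteq> 0"
      using a by (metis (mono_tags, lifting) power_zero_numeral sum.neutral zero_neq_one)
    then show ?thesis
      using I by (intro sum_pos2[of I i]) (auto simp: normal_density_pos)
  qed
  have "(\<integral>\<^sup>+ g. indicator A (\<Sum>i\<in>I. a i * T (g i)) * ?D g *
      (sqrt (2 * pi) * exp ((\<Sum>i\<in>I. a i * g i)\<^sup>2 / 2)) \<partial>?P) \<le> (\<integral>\<^sup>+ x. indicat_real A x \<partial>lborel)"
    using T by (intro transport_density_bound[OF I a])
      (auto intro!: continuous_intros continuous_on_std_normal_density)
  also have "\<dots> = 0"
    using null_setsD1[OF A] by (simp add: ennreal_indicator)
  finally have "AE g in ?P. ennreal (indicator A (\<Sum>i\<in>I. a i * T (g i)) * ?D g *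
      (sqrt (2 * pi) * exp ((\<Sum>i\<in>I. a i * g i)\<^sup>2 / 2))) = 0"
    by (subst nn_integral_0_iff_AE[symmetric]) simp_all
  then have "AE g in ?P. indicator A (\<Sum>i\<in>I. a i * T (g i)) = (0::ennreal)"
  proof eventually_elim
    case (elim g)
    then have "indicat_real A (\<Sum>i\<in>I. a i * T (g i)) * (?D g *
        (sqrt (2 * pi) * exp ((\<Sum>i\<in>I. a i * g i)\<^sup>2 / 2))) \<le> 0"
      by (simp add: mult.assoc ennreal_eq_0_iff)
    moreover have "0 < ?D g * (sqrt (2 * pi) * exp ((\<Sum>i\<in>I. a i * g i)\<^sup>2 / 2))"
      using D by simp
    ultimately show ?case
      by (auto split: split_indicator)
  qed
  then have "(\<integral>\<^sup>+ g. indicator A (\<Sum>i\<in>I. a i * T (g i)) \<partial>?P) = 0"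
    by (subst nn_integral_0_iff_AE) auto
  then show ?thesis
    by (subst nn_integral_PiM_uniform_transport[OF I uni]) auto
qed

text \<open>\<open>R1\<close> and \<open>R2\<close> will have the same finite mean; they stay on opposite sides so that both sides of the
  inequality are nonnegative and can be integrated in \<open>[0, \<infinity>]\<close>.\<close>

lemma gibbs_pointwise_bound:
  fixes y q D R1 R2 :: real
  assumes y: "0 < y" and D: "2 / sqrt (2 * pi) * exp (- R1) \<le> D" and q: "0 \<le> q"
  shows "1 + q + q * R2 \<le> (2 * y) powr - q + q * (y * D * (sqrt (2 * pi) * exp R2)) + q * R1"
proof -
  let ?W = "y * D * (sqrt (2 * pi) * exp R2)"
  have "2 * y * exp (R2 - R1) = y * (2 / sqrt (2 * pi) * exp (- R1)) * (sqrt (2 * pi) * exp R2)"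
    by (simp add: exp_diff exp_minus field_simps)
  also have "\<dots> \<le> ?W"
    using y by (intro mult_right_mono mult_left_mono D) auto
  finally have "ln (2 * y * exp (R2 - R1)) \<le> ln ?W"
    using y by (intro ln_mono) auto
  moreover have "0 < 2 / sqrt (2 * pi) * exp (- R1)"
    by simp
  then have "0 < D"
    using D by (rule less_le_trans)
  then have "0 < ?W"
    using y by simp
  then have "ln ?W \<le> ?W - 1"
    by (rule ln_le_minus_one)
  moreover have "ln (2 * y * exp (R2 - R1)) = ln (2 * y) + R2 - R1"
    using y by (simp add: ln_mult)
  ultimately have "q * (ln (2 * y) + R2 - R1) \<le> q * (?W - 1)"
    using q by (intro mult_left_mono) auto
  moreover have "1 + - q * ln (2 * y) \<le> (2 * y) powr - q"
    using y exp_ge_add_one_self[of "- q * ln (2 * y)"] by (simp add: powr_def)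
  ultimately show ?thesis
    by (simp add: algebra_simps)
qed

text \<open>With q = 1 - p, the integral of \<open>f x powr p\<close> is the mean of
  \<open>Y powr - q\<close>, so the claim is \<open>1 \<le> E\<close> for the mean \<open>E\<close>
  of \<open>(2 * Y g) powr - q\<close>. Integrating \<open>gibbs_pointwise_bound\<close> yields it,
  since \<open>W\<close> has mean at most 1 and \<open>R1\<close>, \<open>R2\<close> both have mean
  1/2.\<close>

lemma nn_integral_powr_ge_uniform:
  fixes a :: "'i \<Rightarrow> real" and f :: "real \<Rightarrow> real"
  assumes I: "finite I" and a: "(\<Sum>i\<in>I. (a i)\<^sup>2) = 1"
    and f [measurable]: "f \<in> borel_measurable borel" and f0: "\<And>x. 0 \<le> f x"
    and law: "\<And>h. h \<in> borel_measurable borel \<Longrightarrow>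
      (\<integral>\<^sup>+ u. h (\<Sum>i\<in>I. a i * u i) \<partial>(\<Pi>\<^sub>M i\<in>I. uniform)) = (\<integral>\<^sup>+ x. ennreal (f x) * h x \<partial>lborel)"
    and p: "0 < p" "p < 1"
  shows "2 powr (1 - p) \<le> (\<integral>\<^sup>+ x. f x powr p \<partial>lborel)"
proof -
  obtain T where T: "\<And>x. (T has_real_derivative 2 * std_normal_density x) (at x)"
    and uni: "distr std_normal borel T = uniform"
    using std_normal_uniform_transport by blast
  note [measurable] = borel_measurable_has_real_derivative[OF T]
  let ?P = "\<Pi>\<^sub>M i\<in>I. std_normal"
  interpret P: prob_space ?P
    by (rule prob_space_PiM_std_normal)
  define q where "q = 1 - p"
  have q: "0 < q" using p by (simp add: q_def)
  define Y where "Y g = f (\<Sum>i\<in>I. a i * T (g i))" for g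
  define D where "D g = (\<Sum>i\<in>I. (a i)\<^sup>2 * (2 * std_normal_density (g i)))" for g
  define R1 where "R1 g = (\<Sum>i\<in>I. (a i)\<^sup>2 * ((g i)\<^sup>2 / 2))" for g
  define R2 where "R2 g = (\<Sum>i\<in>I. a i * g i)\<^sup>2 / 2" for g
  define W where "W g = Y g * D g * (sqrt (2 * pi) * exp (R2 g))" for g
  have [measurable]: "Y \<in> borel_measurable (\<Pi>\<^sub>M i\<in>I. borel)" "D \<in> borel_measurable (\<Pi>\<^sub>M i\<in>I. borel)"
    "R1 \<in> borel_measurable (\<Pi>\<^sub>M i\<in>I. borel)" "R2 \<in> borel_measurable (\<Pi>\<^sub>M i\<in>I. borel)"
    unfolding Y_def D_def R1_def R2_def by measurable
  have [measurable]: "W \<in> borel_measurable (\<Pi>\<^sub>M i\<in>I. borel)"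
    unfolding W_def by measurable
  have nonneg: "0 \<le> W g" "0 \<le> R1 g" "0 \<le> R2 g" for g
    using f0 by (auto simp: W_def R1_def R2_def Y_def D_def intro!: mult_nonneg_nonneg sum_nonneg)
  have law': "(\<integral>\<^sup>+ g. h (\<Sum>i\<in>I. a i * T (g i)) \<partial>?P) = (\<integral>\<^sup>+ x. ennreal (f x) * h x \<partial>lborel)"
    if [measurable]: "h \<in> borel_measurable borel" for h
    using nn_integral_PiM_uniform_transport[OF I uni, of h a] law[of h] by simp
  have mass: "(\<integral>\<^sup>+ x. f x \<partial>lborel) = 1"
    using law'[of "\<lambda>_. 1"] by (simp add: P.emeasure_space_1)
  \<comment> \<open>\<open>W\<close> is precisely the integrand of
    \<open>transport_density_bound\<close> for the derivative 2 \<phi> of \<open>T\<close>, and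
    \<open>f\<close> has total mass 1.\<close>
  have W_le: "(\<integral>\<^sup>+ g. W g \<partial>?P) \<le> 1"
    unfolding W_def Y_def D_def R2_def mass[symmetric] using T f0
    by (intro transport_density_bound[OF I a])
      (auto intro!: continuous_intros continuous_on_std_normal_density)
  have R1_eq: "(\<integral>\<^sup>+ g. R1 g \<partial>?P) = ennreal (1 / 2)"
  proof -
    have sq: "(\<integral>\<^sup>+ g. ennreal ((g i)\<^sup>2) \<partial>?P) = 1" if "i \<in> I" for i
    proof -
      have "(\<integral>\<^sup>+ g. ennreal ((g i)\<^sup>2) \<partial>?P) = (\<integral>\<^sup>+ x. ennreal (x\<^sup>2) \<partial>distr ?P std_normal (\<lambda>g. g i))"
        using that by (subst nn_integral_distr) auto
      also have "\<dots> = 1"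
        using that by (subst distr_PiM_component) (auto intro: prob_space_std_normal nn_integral_std_normal_square)
      finally show ?thesis .
    qed
    have "(\<integral>\<^sup>+ g. R1 g \<partial>?P) = (\<integral>\<^sup>+ g. (\<Sum>i\<in>I. ennreal ((a i)\<^sup>2 / 2) * ennreal ((g i)\<^sup>2)) \<partial>?P)"
      by (intro nn_integral_cong) (simp add: R1_def sum_ennreal[symmetric] ennreal_mult[symmetric] del: sum_ennreal)
    also have "\<dots> = (\<Sum>i\<in>I. ennreal ((a i)\<^sup>2 / 2) * (\<integral>\<^sup>+ g. ennreal ((g i)\<^sup>2) \<partial>?P))"
      by (simp add: nn_integral_sum nn_integral_cmult)
    also have "\<dots> = (\<Sum>i\<in>I. ennreal ((a i)\<^sup>2 / 2))"
      by (intro sum.cong) (simp_all add: sq)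
    also have "\<dots> = ennreal (1 / 2)"
      using a by (simp add: sum_divide_distrib[symmetric])
    finally show ?thesis .
  qed
  have R2_eq: "(\<integral>\<^sup>+ g. R2 g \<partial>?P) = ennreal (1 / 2)"
  proof -
    have "(\<integral>\<^sup>+ g. ennreal ((\<Sum>i\<in>I. a i * g i)\<^sup>2) \<partial>?P) = (\<integral>\<^sup>+ x. ennreal (x\<^sup>2) \<partial>distr ?P borel (\<lambda>g. \<Sum>i\<in>I. a i * g i))"
      by (subst nn_integral_distr) auto
    then have one: "(\<integral>\<^sup>+ g. ennreal ((\<Sum>i\<in>I. a i * g i)\<^sup>2) \<partial>?P) = 1"
      by (simp add: distr_PiM_std_normal_linear[OF I a] nn_integral_std_normal_square)
    have "(\<integral>\<^sup>+ g. R2 g \<partial>?P) = (\<integral>\<^sup>+ g. ennreal (1 / 2) * ennreal ((\<Sum>i\<in>I. a i * g i)\<^sup>2) \<partial>?P)"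
      by (intro nn_integral_cong, subst ennreal_mult[symmetric]) (simp_all add: R2_def)
    then show ?thesis
      by (simp add: nn_integral_cmult one)
  qed
  \<comment> \<open>\<open>D g\<close> is the arithmetic mean of the values 2
    \<phi>(\<open>g i\<close>) with weights \<open>(a i)\<^sup>2\<close>; the left side is their
    geometric mean.\<close>
  have D_ge: "2 / sqrt (2 * pi) * exp (- R1 g) \<le> D g" for g
  proof -
    have "exp (- R1 g) = exp (\<Sum>i\<in>I. (a i)\<^sup>2 * (- (g i)\<^sup>2 / 2))"
      by (simp add: R1_def sum_negf)
    also have "\<dots> \<le> (\<Sum>i\<in>I. (a i)\<^sup>2 * exp (- (g i)\<^sup>2 / 2))"
      using a by (intro exp_weighted_sum_le) auto
    finally have "2 / sqrt (2 * pi) * exp (- R1 g) \<le> 2 / sqrt (2 * pi) * (\<Sum>i\<in>I. (a i)\<^sup>2 * exp (- (g i)\<^sup>2 / 2))"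
      by (intro mult_left_mono) auto
    also have "\<dots> = D g"
      by (simp add: D_def std_normal_density_def sum_distrib_left mult_ac)
    finally show ?thesis .
  qed
  \<comment> \<open>The logarithm in the pointwise bound requires \<open>Y g\<close> to be positive.
    The transported sum has density \<open>f\<close>, so it meets the zero set of \<open>f\<close>
    with probability zero.\<close>
  have pos: "AE g in ?P. 0 < Y g"
  proof -
    have "(\<integral>\<^sup>+ g. indicator {x. f x = 0} (\<Sum>i\<in>I. a i * T (g i)) \<partial>?P)
        = (\<integral>\<^sup>+ x. ennreal (f x) * indicator {x. f x = 0} x \<partial>lborel)"
      by (rule law') measurable
    also have "\<dots> = (\<integral>\<^sup>+ (x::real). 0 \<partial>lborel)"
      by (intro nn_integral_cong) (auto split: split_indicator)
    finally have "AE g in ?P. indicator {x. f x = 0} (\<Sum>i\<in>I. a i * T (g i)) = (0 :: ennreal)"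
      by (subst nn_integral_0_iff_AE[symmetric]) simp_all
    then show ?thesis
      using f0 by (auto elim!: eventually_mono simp: Y_def less_le split: split_indicator_asm)
  qed
  define E where "E = (\<integral>\<^sup>+ g. (2 * Y g) powr - q \<partial>?P)"
  have "ennreal (1 + q) + ennreal q * (\<integral>\<^sup>+ g. R2 g \<partial>?P) = (\<integral>\<^sup>+ g. ennreal (1 + q + q * R2 g) \<partial>?P)"
    using q nonneg by (simp add: ennreal_plus ennreal_mult nn_integral_add nn_integral_cmult P.emeasure_space_1 del: ennreal_plus[symmetric])
  also have "\<dots> \<le> (\<integral>\<^sup>+ g. ennreal ((2 * Y g) powr - q + q * W g + q * R1 g) \<partial>?P)"
    using pos
  proof (intro nn_integral_mono_AE, eventually_elim)
    case (elim g)
    then show ?case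
      unfolding W_def using gibbs_pointwise_bound[OF _ D_ge] q by (intro ennreal_leI) auto
  qed
  also have "\<dots> = E + ennreal q * (\<integral>\<^sup>+ g. W g \<partial>?P) + ennreal q * (\<integral>\<^sup>+ g. R1 g \<partial>?P)"
    using q nonneg by (simp add: E_def ennreal_mult nn_integral_add nn_integral_cmult)
  also have "\<dots> \<le> E + ennreal q * 1 + ennreal q * (\<integral>\<^sup>+ g. R1 g \<partial>?P)"
    by (intro add_mono mult_left_mono W_le) auto
  \<comment> \<open>The terms from \<open>R1\<close> and \<open>R2\<close> both equal q / 2; being
    finite, they cancel in \<open>ennreal\<close>.\<close>
  finally have "ennreal (1 + q) \<le> E + ennreal q"
    by (simp add: R1_eq R2_eq ennreal_mult_eq_top_iff)
  then have E_ge: "1 \<le> E"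
    using q by (cases E) (auto simp: ennreal_plus[symmetric] ennreal_1[symmetric] simp del: ennreal_plus ennreal_1)
  have "E = (\<integral>\<^sup>+ x. ennreal (f x) * ennreal ((2 * f x) powr - q) \<partial>lborel)"
    unfolding E_def Y_def by (rule law') measurable
  also have "\<dots> = (\<integral>\<^sup>+ x. ennreal (2 powr - q) * ennreal (f x powr p) \<partial>lborel)"
  proof (intro nn_integral_cong)
    fix x
    \<comment> \<open>The identity includes the case \<open>f x = 0\<close>: \<open>0 powr r\<close>
      is 0 for every \<open>r\<close>, so both sides vanish.\<close>
    have "f x * (2 * f x) powr - q = 2 powr - q * (f x powr 1 * f x powr - q)"
      using f0[of x] by (simp add: powr_mult)
    also have "f x powr 1 * f x powr - q = f x powr p"
      by (simp only: powr_add[symmetric]) (simp add: q_def)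
    finally show "ennreal (f x) * ennreal ((2 * f x) powr - q) = ennreal (2 powr - q) * ennreal (f x powr p)"
      using f0[of x] by (simp add: ennreal_mult[symmetric])
  qed
  also have "\<dots> = ennreal (2 powr - q) * (\<integral>\<^sup>+ x. f x powr p \<partial>lborel)"
    by (rule nn_integral_cmult) simp
  finally have "ennreal (2 powr q) * 1 \<le> ennreal (2 powr q) * (ennreal (2 powr - q) * (\<integral>\<^sup>+ x. f x powr p \<partial>lborel))"
    using E_ge by (intro mult_left_mono) auto
  also have "\<dots> = (\<integral>\<^sup>+ x. f x powr p \<partial>lborel)"
    by (simp add: mult.assoc[symmetric] ennreal_mult[symmetric] powr_add[symmetric])
  finally show ?thesis
    by (simp add: q_def)
qed

section \<open>From power integrals to entropies\<close>

lemma ln_ennreal_mono: "x \<le> y \<Longrightarrow> ln_ennreal x \<le> ln_ennreal y"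
  by (cases x; cases y) (auto simp: ln_ennreal_def top_unique)

text \<open>\<open>renyi_entropy_distributed\<close> works with a real density. The Radon-Nikodym
  derivative of a probability law is finite almost everywhere, so \<open>enn2real\<close> alters it
  only on a null set.\<close>

lemma absolutely_continuous_real_density:
  assumes "prob_space M" and X: "X \<in> borel_measurable M"
    and ac: "absolutely_continuous lborel (distr M lborel X)"
  shows "\<exists>f\<in>borel_measurable borel. (\<forall>x. 0 \<le> f x) \<and> distributed M lborel X (\<lambda>x. ennreal (f x))"
proof -
  interpret M: prob_space M by fact
  interpret D: prob_space "distr M lborel X"
    by (rule M.prob_space_distr) (use X in simp)
  let ?R = "RN_deriv lborel (distr M lborel X)"
  have "AE x in lborel. ?R x \<noteq> \<infinity>"
    by (rule sigma_finite_measure.RN_deriv_finite[OF sigma_finite_lborel D.sigma_finite_measure_axioms ac]) simp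
  then have "density lborel (\<lambda>x. ennreal (enn2real (?R x))) = density lborel ?R"
    by (intro density_cong) (auto elim!: eventually_mono simp: less_top)
  then have "density lborel (\<lambda>x. ennreal (enn2real (?R x))) = distr M lborel X"
    using sigma_finite_measure.density_RN_deriv[OF sigma_finite_lborel ac] by simp
  then show ?thesis
    using X by (intro bexI[of _ "\<lambda>x. enn2real (?R x)"]) (auto simp: distributed_def)
qed

lemma PiM_uniform_mgf_le:
  fixes a :: "'i \<Rightarrow> real"
  assumes I: "finite I"
  shows "(\<integral>\<^sup>+ u. exp (r * (\<Sum>i\<in>I. a i * u i)) \<partial>(\<Pi>\<^sub>M i\<in>I. uniform)) \<le> exp (r\<^sup>2 * (\<Sum>i\<in>I. (a i)\<^sup>2) / 6)"
proof -
  interpret product_sigma_finite "\<lambda>_::'i. uniform"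
    by (rule product_sigma_finite_prob[OF prob_space_uniform])
  have "(\<integral>\<^sup>+ u. exp (r * (\<Sum>i\<in>I. a i * u i)) \<partial>(\<Pi>\<^sub>M i\<in>I. uniform))
      = (\<integral>\<^sup>+ u. (\<Prod>i\<in>I. ennreal (exp (r * a i * u i))) \<partial>(\<Pi>\<^sub>M i\<in>I. uniform))"
    using I by (intro nn_integral_cong) (simp add: sum_distrib_left exp_sum prod_ennreal mult.assoc)
  also have "\<dots> = (\<Prod>i\<in>I. \<integral>\<^sup>+ x. exp (r * a i * x) \<partial>uniform)"
    by (rule product_nn_integral_prod[OF I]) simp
  also have "\<dots> \<le> (\<Prod>i\<in>I. ennreal (exp ((r * a i)\<^sup>2 / 6)))"
    by (intro prod_mono_ennreal uniform_mgf_le)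
  also have "\<dots> = exp (r\<^sup>2 * (\<Sum>i\<in>I. (a i)\<^sup>2) / 6)"
    using I by (simp add: prod_ennreal exp_sum[symmetric] power_mult_distrib sum_distrib_left sum_divide_distrib)
  finally show ?thesis .
qed

theorem theorem2:
  fixes M :: "'a measure" and U :: "nat \<Rightarrow> 'a \<Rightarrow> real"
    and N :: "'b measure" and Z :: "'b \<Rightarrow> real"
    and a :: "nat \<Rightarrow> real" and n :: nat and p :: real
  assumes "prob_space M"
    and "prob_space.indep_vars M (\<lambda>_. borel) U {1..}"
    and "\<And>j. j \<ge> 1 \<Longrightarrow>
      distributed M lborel (U j) (\<lambda>x. indicator {-1..1} x / measure lborel {-1..1::real})"
    and "prob_space N"
    and "distributed N lborel Z std_normal_density"
    and "0 < p" and "p < 1"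
    and "n \<ge> 1"
    and "(\<Sum>j=1..n. (a j)\<^sup>2) = 1"
  shows "renyi_entropy M p (U 1) \<le> renyi_entropy M p (\<lambda>\<omega>. \<Sum>j=1..n. a j * U j \<omega>) \<and>
    renyi_entropy M p (\<lambda>\<omega>. \<Sum>j=1..n. a j * U j \<omega>) \<le> renyi_entropy N p (\<lambda>\<omega>. Z \<omega> / sqrt 3)"
proof -
  interpret M: prob_space M by fact
  interpret N: prob_space N by fact
  have p: "0 < p" "p < 1" by fact+
  let ?I = "{1..n}"
  let ?U = "\<Pi>\<^sub>M j\<in>?I. uniform"
  have I: "finite ?I" by simp
  have a: "(\<Sum>j\<in>?I. (a j)\<^sup>2) = 1" by fact
  let ?u = "\<lambda>x. indicator {-1..1::real} x / 2 :: real"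
  let ?g = "normal_density 0 (1 / sqrt 3)"
  define X where "X \<omega> = (\<Sum>j=1..n. a j * U j \<omega>)" for \<omega>
  have U: "distributed M lborel (U j) (\<lambda>x. ennreal (?u x))" if "j \<ge> 1" for j
  proof -
    have "(\<lambda>x. indicator {-1..1} x / measure lborel {-1..1::real}) = (\<lambda>x. ennreal (?u x))"
      by (auto simp: fun_eq_iff split: split_indicator)
    with assms(3)[OF that] show ?thesis by simp
  qed
  have [measurable]: "U j \<in> borel_measurable M" if "j \<in> ?I" for j
    using distributed_measurable[OF U[of j]] that by simp
  have X [measurable]: "X \<in> borel_measurable M"
    unfolding X_def by measurable
  have distr_U: "distr M borel (U j) = uniform" if "j \<in> ?I" for j
  proof -
    have "distr M borel (U j) = distr M lborel (U j)"
      by (rule distr_cong) auto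
    also have "\<dots> = density lborel (\<lambda>x. ennreal (?u x))"
      using U[of j] that by (simp add: distributed_def)
    also have "\<dots> = uniform"
      unfolding uniform_measure_def
      by (intro density_cong) (auto split: split_indicator simp: divide_ennreal[symmetric])
    finally show ?thesis .
  qed
  have "M.indep_vars (\<lambda>_. borel) U ?I"
    by (rule M.indep_vars_subset[OF assms(2)]) auto
  moreover have "(\<Pi>\<^sub>M j\<in>?I. distr M borel (U j)) = ?U"
    by (intro PiM_cong distr_U) simp
  \<comment> \<open>Independence gives the product as joint law; the characterisation used is for
    nonempty index sets, hence the appeal to \<open>n \<ge> 1\<close>.\<close>
  ultimately have joint: "distr M (\<Pi>\<^sub>M j\<in>?I. borel) (\<lambda>\<omega>. \<lambda>j\<in>?I. U j \<omega>) = ?U"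
    using \<open>n \<ge> 1\<close> by (subst (asm) M.indep_vars_iff_distr_eq_PiM') simp_all
  have law: "(\<integral>\<^sup>+ \<omega>. h (X \<omega>) \<partial>M) = (\<integral>\<^sup>+ u. h (\<Sum>j\<in>?I. a j * u j) \<partial>?U)"
    if [measurable]: "h \<in> borel_measurable borel" for h :: "real \<Rightarrow> ennreal"
    by (subst joint[symmetric], subst nn_integral_distr) (simp_all add: X_def)
  \<comment> \<open>The entropy of \<open>X\<close> can be computed from a density once its law is
    known to have one; null sets are handled by passing to the product of uniform laws.\<close>
  have "absolutely_continuous lborel (distr M lborel X)"
    unfolding absolutely_continuous_def
  proof
    fix A :: "real set" assume A: "A \<in> null_sets lborel"
    then have [measurable]: "A \<in> sets borel" by auto
    have "emeasure (distr M lborel X) A = (\<integral>\<^sup>+ \<omega>. indicator A (X \<omega>) \<partial>M)"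
      by (subst nn_integral_indicator[symmetric], simp, subst nn_integral_distr) simp_all
    also have "\<dots> = (\<integral>\<^sup>+ u. indicator A (\<Sum>j\<in>?I. a j * u j) \<partial>?U)"
      by (rule law) simp
    also have "\<dots> = 0"
      by (rule uniform_sum_absolutely_continuous[OF I a A])
    finally show "A \<in> null_sets (distr M lborel X)"
      by (simp add: null_sets_def)
  qed
  then obtain f where f [measurable]: "f \<in> borel_measurable borel" and f0: "\<And>x. 0 \<le> f x"
    and Xf: "distributed M lborel X (\<lambda>x. ennreal (f x))"
    using absolutely_continuous_real_density[OF \<open>prob_space M\<close> X] by blast
  have dens: "density lborel (\<lambda>x. ennreal (f x)) = distr M lborel X"
    using Xf by (simp add: distributed_def)
  have lower: "2 powr (1 - p) \<le> (\<integral>\<^sup>+ x. f x powr p \<partial>lborel)"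
    using law distributed_nn_integral[OF Xf]
    by (intro nn_integral_powr_ge_uniform[OF I a f f0 _ p]) simp
  have upper: "(\<integral>\<^sup>+ x. f x powr p \<partial>lborel) \<le> (\<integral>\<^sup>+ x. ?g x powr p \<partial>lborel)"
  proof (rule nn_integral_powr_le_normal[OF f f0 _ _ _ p])
    show "prob_space (density lborel (\<lambda>x. ennreal (f x)))"
      unfolding dens by (rule M.prob_space_distr) simp
    fix r :: real
    have "(\<integral>\<^sup>+ x. exp (r * x) \<partial>density lborel (\<lambda>x. ennreal (f x))) = (\<integral>\<^sup>+ \<omega>. exp (r * X \<omega>) \<partial>M)"
      unfolding dens by (subst nn_integral_distr) auto
    also have "\<dots> = (\<integral>\<^sup>+ u. exp (r * (\<Sum>j\<in>?I. a j * u j)) \<partial>?U)"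
      by (rule law) simp
    also have "\<dots> \<le> exp (r\<^sup>2 * (\<Sum>j\<in>?I. (a j)\<^sup>2) / 6)"
      by (rule PiM_uniform_mgf_le[OF I])
    \<comment> \<open>A uniform variable on [-1,1] has variance 1/3, so the exponent r^2 / 6 is that
      of the Gaussian with the same variance.\<close>
    also have "\<dots> = exp ((1 / sqrt 3)\<^sup>2 * r\<^sup>2 / 2)"
      by (simp only: a) (simp add: power_divide)
    finally show "(\<integral>\<^sup>+ x. exp (r * x) \<partial>density lborel (\<lambda>x. ennreal (f x))) \<le> exp ((1 / sqrt 3)\<^sup>2 * r\<^sup>2 / 2)" .
  qed simp
  \<comment> \<open>The constant in \<open>lower\<close> is the power integral of the uniform
    density itself.\<close>
  have "(\<integral>\<^sup>+ x. ?u x powr p \<partial>lborel) = (\<integral>\<^sup>+ x. ennreal ((1 / 2) powr p) * indicator {-1..1::real} x \<partial>lborel)"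
    by (intro nn_integral_cong) (auto split: split_indicator)
  also have "\<dots> = ennreal ((1 / 2) powr p) * ennreal 2"
    by (subst nn_integral_cmult_indicator) auto
  also have "\<dots> = 2 powr (1 - p)"
    by (subst ennreal_mult[symmetric]) (simp_all add: powr_divide powr_diff)
  finally have u: "(\<integral>\<^sup>+ x. ?u x powr p \<partial>lborel) = 2 powr (1 - p)" .
  have "distributed N lborel (\<lambda>\<omega>. Z \<omega> / sqrt 3) ?g"
    using N.normal_density_affine[OF assms(5), of "1 / sqrt 3" 0] by simp
  then have Z: "renyi_entropy N p (\<lambda>\<omega>. Z \<omega> / sqrt 3) =
      ereal (1 / (1 - p)) * ln_ennreal (\<integral>\<^sup>+ x. ?g x powr p \<partial>lborel)"
    by (rule renyi_entropy_distributed) simp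
  have "renyi_entropy M p (U 1) \<le> renyi_entropy M p X"
    unfolding renyi_entropy_distributed[OF Xf f0] u
    by (subst renyi_entropy_distributed[OF U]) (use p lower in \<open>auto simp: u intro!: ereal_mult_left_mono ln_ennreal_mono\<close>)
  moreover have "renyi_entropy M p X \<le> renyi_entropy N p (\<lambda>\<omega>. Z \<omega> / sqrt 3)"
    unfolding renyi_entropy_distributed[OF Xf f0] Z
    using p upper by (auto intro!: ereal_mult_left_mono ln_ennreal_mono)
  ultimately show ?thesis
    unfolding X_def by blast
qed

end
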